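(* Let $F:\mathbb{R}^n\times\mathbb{R}^m\to\mathbb{R}$ be continuously differentiable and globally strictly convex-concave, with $\operatorname{Saddle}(F)\neq\emptyset$. Then $\operatorname{Saddle}(F)$ is globally asymptotically stable under the saddle-point dynamics $X_{\text{sp}}$ of $F$, and the convergence of trajectories is to a point.
   Context: Saddle-point dynamics: for a continuously differentiable $F:\mathbb{R}^n\times\mathbb{R}^m\to\mathbb{R}$ it is $\dot x=-\nabla_xF(x,z)$, $\dot z=\nabla_zF(x,z)$, with vector field denoted $X_{\text{sp}}$. Trajectories are solutions on $t\ge 0$. Saddle points: $(x_*,z_* )$ is a (local min-max) saddle point of $F$ if there are open neighborhoods $\mathcal U_{x_*}\subset\mathbb{R}^n$ of $x_*$ and $\mathcal U_{z_*}\subset\mathbb{R}^m$ of $z_*$ with $F(x_*,z)\le F(x_*,z_* )\le F(x,z_* )$ for all $z\in\mathcal U_{z_*}$, $x\in\mathcal U_{x_*}$. $\operatorname{Saddle}(F)$ is the set of all such points; it is assumed nonempty. Global convexity-concavity: $F$ is globally convex-concave if $x\mapsto F(x,\bar z)$ is convex on $\mathbb{R}^n$ and $z\mapsto F(\bar x,z)$ is concave on $\mathbb{R}^m$ for all $(\bar x,\bar z)\in\mathbb{R}^n\times\mathbb{R}^m$. $F$ is globally strictly convex-concave if it is globally convex-concave and, for any $(\bar x,\bar z)\in\mathbb{R}^n\times\mathbb{R}^m$, either $x\mapsto F(x,\bar z)$ is strictly convex or $z\mapsto F(\bar x,z)$ is strictly concave. Stability: a set $\mathcal S$ of equilibria is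 globally asymptotically stable if for every $\epsilon>0$ there is an open set $W\supset\mathcal S$ such that every trajectory starting in $W$ stays within distance less than $\epsilon$ of $\mathcal S$ for all $t\ge0$, and the distance to $\mathcal S$ of every trajectory tends to $0$ as $t\to\infty$. "Convergence is to a point" means every trajectory converges to a single point of $\mathcal S$. *)

theory Defs
  imports "HOL-Analysis.Analysis"
begin

definition gradient :: "('a::real_inner \<Rightarrow> real) \<Rightarrow> 'a \<Rightarrow> 'a" where
  "gradient f x = (THE D. GDERIV f x :> D)"

definition continuously_differentiable :: "('a::real_inner \<Rightarrow> real) \<Rightarrow> bool" where
  "continuously_differentiable f \<longleftrightarrow>
     (\<exists>G. (\<forall>x. GDERIV f x :> G x) \<and> continuous_on UNIV G)"

definition strictly_convex_on :: "'a::real_vector set \<Rightarrow> ('a \<Rightarrow> real) \<Rightarrow> bool" where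
  "strictly_convex_on S f \<longleftrightarrow> convex S \<and>
     (\<forall>x\<in>S. \<forall>y\<in>S. \<forall>u>0. \<forall>v>0. x \<noteq> y \<longrightarrow> u + v = 1 \<longrightarrow>
        f (u *\<^sub>R x + v *\<^sub>R y) < u * f x + v * f y)"

definition strictly_concave_on :: "'a::real_vector set \<Rightarrow> ('a \<Rightarrow> real) \<Rightarrow> bool" where
  "strictly_concave_on S f \<longleftrightarrow> strictly_convex_on S (\<lambda>x. - f x)"

definition globally_convex_concave ::
    "('a::real_vector \<times> 'b::real_vector \<Rightarrow> real) \<Rightarrow> bool" where
  "globally_convex_concave F \<longleftrightarrow>
     (\<forall>xbar zbar. convex_on UNIV (\<lambda>x. F (x, zbar)) \<and> concave_on UNIV (\<lambda>z. F (xbar, z)))"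

text \<open>Which of the two alternatives holds may depend on the point.\<close>

definition globally_strictly_convex_concave ::
    "('a::real_vector \<times> 'b::real_vector \<Rightarrow> real) \<Rightarrow> bool" where
  "globally_strictly_convex_concave F \<longleftrightarrow>
     globally_convex_concave F \<and>
     (\<forall>xbar zbar. strictly_convex_on UNIV (\<lambda>x. F (x, zbar)) \<or>
                  strictly_concave_on UNIV (\<lambda>z. F (xbar, z)))"

text \<open>Local min-max saddle points: minimum in the first, maximum in the second argument.\<close>

definition Saddle ::
    "('a::topological_space \<times> 'b::topological_space \<Rightarrow> real) \<Rightarrow> ('a \<times> 'b) set" where
  "Saddle F = {(xs, zs). \<exists>U V. open U \<and> xs \<in> U \<and> open V \<and> zs \<in> V \<and>
     (\<forall>x\<in>U. \<forall>z\<in>V. F (xs, z) \<le> F (xs, zs) \<and> F (xs, zs) \<le> F (x, zs))}"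

definition X_sp ::
    "('a::real_inner \<times> 'b::real_inner \<Rightarrow> real) \<Rightarrow> 'a \<times> 'b \<Rightarrow> 'a \<times> 'b" where
  "X_sp F = (\<lambda>(x, z). (- gradient (\<lambda>x'. F (x', z)) x, gradient (\<lambda>z'. F (x, z')) z))"

text \<open>Only the values at times \<open>t \<ge> 0\<close> matter; at \<open>0\<close> the derivative is one-sided.\<close>

definition is_trajectory :: "('a::real_normed_vector \<Rightarrow> 'a) \<Rightarrow> (real \<Rightarrow> 'a) \<Rightarrow> bool" where
  "is_trajectory X \<gamma> \<longleftrightarrow>
     (\<forall>t\<ge>0. (\<gamma> has_vector_derivative X (\<gamma> t)) (at t within {0..}))"

text \<open>Meaningful for nonempty \<open>S\<close>, since \<open>infdist p {} = 0\<close>. The first conjunct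
  records that \<open>S\<close> is a set of equilibria.\<close>

definition globally_asymptotically_stable ::
    "('a::real_normed_vector \<Rightarrow> 'a) \<Rightarrow> 'a set \<Rightarrow> bool" where
  "globally_asymptotically_stable X S \<longleftrightarrow>
     (\<forall>p\<in>S. X p = 0) \<and>
     (\<forall>\<epsilon>>0. \<exists>W. open W \<and> S \<subseteq> W \<and>
        (\<forall>\<gamma>. is_trajectory X \<gamma> \<longrightarrow> \<gamma> 0 \<in> W \<longrightarrow> (\<forall>t\<ge>0. infdist (\<gamma> t) S < \<epsilon>))) \<and>
     (\<forall>\<gamma>. is_trajectory X \<gamma> \<longrightarrow> ((\<lambda>t. infdist (\<gamma> t) S) \<longlongrightarrow> 0) at_top)"

definition convergence_to_a_point ::
    "('a::real_normed_vector \<Rightarrow> 'a) \<Rightarrow> 'a set \<Rightarrow> bool" where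
  "convergence_to_a_point X S \<longleftrightarrow>
     (\<forall>\<gamma>. is_trajectory X \<gamma> \<longrightarrow> (\<exists>p\<in>S. (\<gamma> \<longlongrightarrow> p) at_top))"

end

theory Submission
  imports Defs
begin

text \<open>A vector field \<open>X\<close> with \<open>X q \<bullet> (q - p) \<le> 0\<close> for every saddle point \<open>p\<close> makes the distance
  of a trajectory to each saddle point nonincreasing; this gives stability and boundedness, and it
  upgrades a single saddle cluster point to a limit. To find such a cluster point under mere \<open>C\<^sup>1\<close>
  regularity, the invariance step of LaSalle's principle (which would need solutions through limit
  points) is replaced by Barbalat's lemma, applied twice: first to \<open>|\<gamma> - p|\<^sup>2\<close>, which forces
  \<open>F (x, z\<^sub>*) - F (x\<^sub>*, z) \<rightarrow> 0\<close> and hence, in the strictly convex case, \<open>x \<rightarrow> x\<^sub>*\<close>; then to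
  the convergent component \<open>x\<close> itself, which forces \<open>\<nabla>\<^sub>x F \<rightarrow> 0\<close>. The strictly concave case is
  symmetric.\<close>

section \<open>Limits at infinity: Barbalat's lemma and a compactness principle\<close>

lemma barbalat:
  fixes y :: "real \<Rightarrow> 'a::real_normed_vector"
  assumes deriv: "\<And>t. t \<ge> 0 \<Longrightarrow> (y has_vector_derivative y' t) (at t within {0..})"
    and uc: "uniformly_continuous_on {0..} y'"
    and lim: "(y \<longlongrightarrow> l) at_top"
  shows "(y' \<longlongrightarrow> 0) at_top"
proof (rule tendstoI)
  fix e :: real assume "e > 0"
  obtain d where "d > 0"
    and d: "\<And>s t. s \<ge> 0 \<Longrightarrow> t \<ge> 0 \<Longrightarrow> dist s t < d \<Longrightarrow> dist (y' s) (y' t) < e / 2"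
    using uc \<open>e > 0\<close> unfolding uniformly_continuous_on_def
    by (metis atLeast_iff half_gt_zero)
  \<comment> \<open>Over a window of fixed length \<open>k\<close> the increment of \<open>y\<close>
    tends to 0, while \<open>y'\<close> stays within \<open>e / 2\<close> of \<open>y' t\<close>, so
    the increment is close to \<open>k *\<^sub>R y' t\<close>. Halving \<open>d\<close> fits the
    closed window into the strict bound \<open>dist s t < d\<close>.\<close>
  define k where "k = d / 2"
  have "k > 0" "k < d" using \<open>d > 0\<close> by (auto simp: k_def)
  have "((\<lambda>t. y (t + k)) \<longlongrightarrow> l) at_top"
    using filterlim_compose[OF lim filterlim_tendsto_add_at_top[OF tendsto_const filterlim_ident],
        of k] by (simp add: add.commute)
  from tendsto_diff[OF this lim]
  have "((\<lambda>t. y (t + k) - y t) \<longlongrightarrow> 0) at_top" by simp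
  then have "\<forall>\<^sub>F t in at_top. norm (y (t + k) - y t) < k * (e / 2)"
    using \<open>k > 0\<close> \<open>e > 0\<close> by (auto dest!: tendstoD[where e = "k * (e / 2)"] simp: dist_norm)
  then show "\<forall>\<^sub>F t in at_top. dist (y' t) 0 < e"
    using eventually_ge_at_top[of 0]
  proof eventually_elim
    case (elim t)
    have "norm (y (t + k) - y t - (t + k - t) *\<^sub>R y' t) \<le> norm (t + k - t) * (e / 2)"
    proof (rule vector_differentiable_bound_linearization)
      show "(y has_vector_derivative y' s) (at s within {t..t+k})" if "s \<in> {t..t+k}" for s
        using deriv[of s] that elim(2) by (auto intro: has_vector_derivative_within_subset)
      show "norm (y' s - y' t) \<le> e / 2" if "s \<in> {t..t+k}" for s
        using d[of s t] that elim(2) \<open>k < d\<close> by (auto simp: dist_norm)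
    qed (use \<open>k > 0\<close> in \<open>auto simp: closed_segment_eq_real_ivl\<close>)
    then have "norm (k *\<^sub>R y' t - (y (t + k) - y t)) \<le> k * (e / 2)"
      using \<open>k > 0\<close> by (simp add: norm_minus_commute)
    with elim(1) norm_triangle_sub[of "k *\<^sub>R y' t" "y (t + k) - y t"]
    have "norm (k *\<^sub>R y' t) < k * e" by simp
    then show ?case using \<open>k > 0\<close> by simp
  qed
qed

lemma antimono_bounded_below_tendsto:
  fixes f :: "real \<Rightarrow> real"
  assumes mono: "\<And>s t. 0 \<le> s \<Longrightarrow> s \<le> t \<Longrightarrow> f t \<le> f s" and lb: "\<And>t. 0 \<le> t \<Longrightarrow> b \<le> f t"
  shows "\<exists>l. (f \<longlongrightarrow> l) at_top"
proof -
  define l where "l = Inf (f ` {0..})"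
  have bdd: "bdd_below (f ` {0..})" using lb by (auto simp: bdd_below_def)
  have "(f \<longlongrightarrow> l) at_top"
  proof (rule decreasing_tendsto)
    show "\<forall>\<^sub>F t in at_top. l \<le> f t"
      using eventually_ge_at_top[of 0]
      by eventually_elim (auto simp: l_def intro!: cInf_lower bdd)
  next
    fix x assume "l < x"
    then obtain s where s: "0 \<le> s" "f s < x"
      unfolding l_def using cInf_less_iff[OF _ bdd] by auto
    show "\<forall>\<^sub>F t in at_top. f t < x"
      using eventually_ge_at_top[of s] by eventually_elim (use s mono in fastforce)
  qed
  then show ?thesis by blast
qed

text \<open>On the compact part of the orbit closure where \<open>norm (h q)\<close> is at least
  \<open>e\<close>, \<open>g\<close> has no zero, so its norm has a positive minimum there; once
  \<open>g\<close> along the orbit falls below it, the orbit has left that part.\<close>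

lemma tendsto_zero_of_zero_set:
  fixes \<gamma> :: "real \<Rightarrow> 'a::heine_borel"
    and g :: "'a \<Rightarrow> 'b::real_normed_vector" and h :: "'a \<Rightarrow> 'c::real_normed_vector"
  assumes bdd: "bounded (\<gamma> ` {0..})"
    and cont: "continuous_on UNIV g" "continuous_on UNIV h"
    and g: "((\<lambda>t. g (\<gamma> t)) \<longlongrightarrow> 0) at_top"
    and imp: "\<And>q. g q = 0 \<Longrightarrow> h q = 0"
  shows "((\<lambda>t. h (\<gamma> t)) \<longlongrightarrow> 0) at_top"
proof (rule tendstoI)
  fix e :: real assume "e > 0"
  define K where "K = closure (\<gamma> ` {0..}) \<inter> {q. e \<le> norm (h q)}"
  have "compact K" unfolding K_def
    using bdd by (intro compact_Int_closed closed_Collect_le continuous_intros cont) auto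
  have "\<exists>m>0. \<forall>q\<in>K. m \<le> norm (g q)"
  proof (cases "K = {}")
    case False
    obtain q where q: "q \<in> K" "\<forall>p\<in>K. norm (g q) \<le> norm (g p)"
      using continuous_attains_inf[OF \<open>compact K\<close> False, of "\<lambda>q. norm (g q)"]
        continuous_on_norm[OF continuous_on_subset[OF cont(1) subset_UNIV]] by blast
    have "g q \<noteq> 0" using q(1) imp[of q] \<open>e > 0\<close> by (auto simp: K_def)
    then show ?thesis using q(2) by (intro exI[of _ "norm (g q)"]) auto
  qed (auto intro: exI[of _ 1])
  then obtain m where "m > 0" and m: "\<And>q. q \<in> K \<Longrightarrow> m \<le> norm (g q)" by blast
  have "\<forall>\<^sub>F t in at_top. norm (g (\<gamma> t)) < m"
    using tendstoD[OF g \<open>m > 0\<close>] by simp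
  then show "\<forall>\<^sub>F t in at_top. dist (h (\<gamma> t)) 0 < e"
    using eventually_ge_at_top[of 0]
  proof eventually_elim
    case (elim t)
    have "\<gamma> t \<in> closure (\<gamma> ` {0..})" using elim(2) closure_subset by fastforce
    then show ?case using elim(1) m[of "\<gamma> t"] by (fastforce simp: K_def)
  qed
qed

section \<open>Trajectories of a field along which distances do not grow\<close>

lemma trajectory_uniformly_continuous:
  fixes X :: "'a::euclidean_space \<Rightarrow> 'a" and h :: "'a \<Rightarrow> 'b::metric_space"
  assumes traj: "is_trajectory X \<gamma>" and bdd: "bounded (\<gamma> ` {0..})"
    and cont: "continuous_on UNIV X" "continuous_on UNIV h"
  shows "uniformly_continuous_on {0..} (\<lambda>t. h (\<gamma> t))"
proof -
  define K where "K = closure (\<gamma> ` {0..})"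
  have "compact K" using bdd by (simp add: K_def)
  have sub: "\<gamma> ` {0..} \<subseteq> K" by (simp add: K_def closure_subset)
  have "bounded (X ` K)"
    by (intro compact_imp_bounded compact_continuous_image \<open>compact K\<close>
        continuous_on_subset[OF cont(1)]) auto
  then obtain B where B: "\<And>q. q \<in> K \<Longrightarrow> norm (X q) \<le> B"
    by (auto simp: bounded_iff)
  have "0 \<le> B" using order_trans[OF norm_ge_zero B[of "\<gamma> 0"]] sub by auto
  \<comment> \<open>Bounded speed makes \<open>\<gamma>\<close> Lipschitz; with uniform continuity
    of \<open>h\<close> on the compact orbit closure this supplies the hypothesis of
    \<open>barbalat\<close>.\<close>
  have "B-lipschitz_on {0..} \<gamma>"
  proof (rule bounded_derivative_imp_lipschitz)
    fix t :: real assume t: "t \<in> {0..}"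
    show "(\<gamma> has_derivative (\<lambda>h. h *\<^sub>R X (\<gamma> t))) (at t within {0..})"
      using traj t by (auto simp: is_trajectory_def has_vector_derivative_def)
    have "norm (X (\<gamma> t)) \<le> B" using B sub t by auto
    then show "onorm (\<lambda>h. h *\<^sub>R X (\<gamma> t)) \<le> B"
      using \<open>0 \<le> B\<close> by (intro onorm_bound) (auto simp: mult.commute[of B] mult_left_mono)
  qed (use \<open>0 \<le> B\<close> in auto)
  then have "uniformly_continuous_on {0..} \<gamma>"
    by (rule lipschitz_on_uniformly_continuous)
  moreover have "uniformly_continuous_on (\<gamma> ` {0..}) h"
    using compact_uniformly_continuous[OF continuous_on_subset[OF cont(2) subset_UNIV] \<open>compact K\<close>] sub
    unfolding uniformly_continuous_on_def by (meson subsetD)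
  ultimately show ?thesis by (rule uniformly_continuous_on_compose)
qed

lemma trajectory_norm_square_derivative:
  fixes X :: "'a::real_inner \<Rightarrow> 'a"
  assumes "is_trajectory X \<gamma>" "t \<ge> 0"
  shows "((\<lambda>t. (norm (\<gamma> t - p))\<^sup>2) has_vector_derivative 2 * (X (\<gamma> t) \<bullet> (\<gamma> t - p)))
    (at t within {0..})"
proof -
  have "(\<gamma> has_derivative (\<lambda>h. h *\<^sub>R X (\<gamma> t))) (at t within {0..})"
    using assms by (auto simp: is_trajectory_def has_vector_derivative_def)
  then show ?thesis
    unfolding has_vector_derivative_def power2_norm_eq_inner
    by (auto intro!: derivative_eq_intros simp: inner_commute algebra_simps)
qed

lemma trajectory_dist_antimono:
  fixes X :: "'a::real_inner \<Rightarrow> 'a"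
  assumes traj: "is_trajectory X \<gamma>" and le: "\<And>q. X q \<bullet> (q - p) \<le> 0"
    and st: "0 \<le> s" "s \<le> t"
  shows "dist (\<gamma> t) p \<le> dist (\<gamma> s) p"
proof -
  have "((\<lambda>t. (norm (\<gamma> t - p))\<^sup>2) has_derivative (\<lambda>h. h * (2 * (X (\<gamma> u) \<bullet> (\<gamma> u - p)))))
      (at u within {s..t})" if "s \<le> u" "u \<le> t" for u
    using trajectory_norm_square_derivative[OF traj, of u p] that st
    unfolding has_vector_derivative_def by (auto intro: has_derivative_subset)
  from mvt_very_simple[OF st(2) this]
  obtain u where "(norm (\<gamma> t - p))\<^sup>2 - (norm (\<gamma> s - p))\<^sup>2 = (t - s) * (2 * (X (\<gamma> u) \<bullet> (\<gamma> u - p)))"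
    by blast
  moreover have "(t - s) * (2 * (X (\<gamma> u) \<bullet> (\<gamma> u - p))) \<le> 0"
    using le[of "\<gamma> u"] st by (simp add: mult_nonneg_nonpos)
  ultimately have "(norm (\<gamma> t - p))\<^sup>2 \<le> (norm (\<gamma> s - p))\<^sup>2" by linarith
  then show ?thesis by (simp add: dist_norm power2_le_iff_abs_le)
qed

lemma trajectory_bounded:
  fixes X :: "'a::real_inner \<Rightarrow> 'a"
  assumes "is_trajectory X \<gamma>" "\<And>q. X q \<bullet> (q - p) \<le> 0"
  shows "bounded (\<gamma> ` {0..})"
proof (rule bounded_subset[OF bounded_cball])
  show "\<gamma> ` {0..} \<subseteq> cball p (dist (\<gamma> 0) p)"
    using trajectory_dist_antimono[OF assms order_refl] by (auto simp: dist_commute)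
qed

text \<open>The squared distance to \<open>p\<close> is nonincreasing and bounded below, hence
  converges, and \<open>barbalat\<close> applies to its derivative.\<close>

lemma trajectory_inner_tendsto_zero:
  fixes X :: "'a::euclidean_space \<Rightarrow> 'a"
  assumes traj: "is_trajectory X \<gamma>" and le: "\<And>q. X q \<bullet> (q - p) \<le> 0"
    and cont: "continuous_on UNIV X"
  shows "((\<lambda>t. X (\<gamma> t) \<bullet> (\<gamma> t - p)) \<longlongrightarrow> 0) at_top"
proof -
  have "\<exists>l. ((\<lambda>t. (norm (\<gamma> t - p))\<^sup>2) \<longlongrightarrow> l) at_top"
    using trajectory_dist_antimono[OF traj le]
    by (intro antimono_bounded_below_tendsto[where b = 0]) (auto simp: dist_norm intro: power_mono)
  then obtain l where l: "((\<lambda>t. (norm (\<gamma> t - p))\<^sup>2) \<longlongrightarrow> l) at_top" ..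
  have "continuous_on UNIV (\<lambda>q. 2 * (X q \<bullet> (q - p)))"
    by (intro continuous_intros cont)
  from trajectory_uniformly_continuous[OF traj trajectory_bounded[OF traj le] cont this]
  have "((\<lambda>t. 2 * (X (\<gamma> t) \<bullet> (\<gamma> t - p))) \<longlongrightarrow> 0) at_top"
    using barbalat[OF trajectory_norm_square_derivative[OF traj] _ l] by blast
  from tendsto_mult[OF tendsto_const[of "1/2"] this] show ?thesis by simp
qed

text \<open>Boundedness gives a cluster point \<open>q\<close>, at which \<open>h\<close> vanishes
  by continuity. By \<open>stable\<close> the distance to \<open>q\<close> never increases, so
  coming close to \<open>q\<close> once means staying close.\<close>

lemma trajectory_tendsto_zero_of_attracting:
  fixes X :: "'a::euclidean_space \<Rightarrow> 'a" and h :: "'a \<Rightarrow> 'b::real_normed_vector"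
  assumes traj: "is_trajectory X \<gamma>" and bdd: "bounded (\<gamma> ` {0..})"
    and stable: "\<And>q p. h q = 0 \<Longrightarrow> X p \<bullet> (p - q) \<le> 0"
    and cont: "continuous_on UNIV h" and lim: "((\<lambda>t. h (\<gamma> t)) \<longlongrightarrow> 0) at_top"
  shows "\<exists>q. h q = 0 \<and> (\<gamma> \<longlongrightarrow> q) at_top"
proof -
  have "compact (closure (\<gamma> ` {0..}))" using bdd by simp
  moreover have "\<forall>n. \<gamma> (real n) \<in> closure (\<gamma> ` {0..})" using closure_subset by fastforce
  ultimately obtain q r where r: "strict_mono r" and q: "((\<lambda>n. \<gamma> (real n)) \<circ> r) \<longlonglongrightarrow> q"
    unfolding compact_eq_seq_compact_metric seq_compact_def by metis
  have real_r: "filterlim (\<lambda>n. real (r n)) at_top sequentially"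
    by (intro filterlim_compose[OF filterlim_real_sequentially] filterlim_subseq r)
  have q': "(\<lambda>n. \<gamma> (real (r n))) \<longlonglongrightarrow> q" using q by (simp add: o_def)
  have "(\<lambda>n. h (\<gamma> (real (r n)))) \<longlonglongrightarrow> h q"
    using continuous_on_tendsto_compose[OF cont q'] by simp
  moreover have "(\<lambda>n. h (\<gamma> (real (r n)))) \<longlonglongrightarrow> 0"
    using filterlim_compose[OF lim real_r] .
  ultimately have "h q = 0" using LIMSEQ_unique by blast
  moreover have "(\<gamma> \<longlongrightarrow> q) at_top"
  proof (rule tendstoI)
    fix e :: real assume "e > 0"
    from tendstoD[OF q' this] obtain n where n: "dist (\<gamma> (real (r n))) q < e"
      by (auto simp: eventually_sequentially)
    show "\<forall>\<^sub>F t in at_top. dist (\<gamma> t) q < e"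
      using eventually_ge_at_top[of "real (r n)"]
    proof eventually_elim
      case (elim t)
      then have "dist (\<gamma> t) q \<le> dist (\<gamma> (real (r n))) q"
        by (intro trajectory_dist_antimono[OF traj] stable \<open>h q = 0\<close>) auto
      with n show ?case by simp
    qed
  qed
  ultimately show ?thesis by blast
qed

section \<open>Gradients and convex functions\<close>

lemma gradient_eqI:
  assumes "GDERIV f x :> D"
  shows "gradient f x = D"
  unfolding gradient_def
proof (rule the_equality)
  show "GDERIV f x :> D" by (fact assms)
next
  fix E assume "GDERIV f x :> E"
  with assms have "(\<lambda>h. h \<bullet> E) = (\<lambda>h. h \<bullet> D)"
    unfolding gderiv_def by (rule has_derivative_unique[OF _ _, rotated])
  then show "E = D" using vector_eq_ldot[of E D] by (auto dest: fun_cong)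
qed

text \<open>Restricting \<open>f\<close> to the line through \<open>x\<close> and \<open>y\<close>,
  with parameters 0 and 1 at these points, reduces this to the tangent inequality in one
  variable.\<close>

lemma convex_gradient_inequality:
  assumes convex: "convex_on UNIV f" and deriv: "GDERIV f x :> D"
  shows "f x + (y - x) \<bullet> D \<le> f y"
proof -
  define \<phi> where "\<phi> s = f (x + s *\<^sub>R (y - x))" for s :: real
  have "convex_on UNIV \<phi>"
  proof (rule convex_onI)
    fix u s t :: real assume "0 < u" "u < 1"
    have "x + ((1 - u) * s + u * t) *\<^sub>R (y - x)
        = (1 - u) *\<^sub>R (x + s *\<^sub>R (y - x)) + u *\<^sub>R (x + t *\<^sub>R (y - x))"
      by (simp add: algebra_simps)
    then show "\<phi> ((1 - u) *\<^sub>R s + u *\<^sub>R t) \<le> (1 - u) * \<phi> s + u * \<phi> t"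
      using convex_onD[OF convex, of u] \<open>0 < u\<close> \<open>u < 1\<close> by (simp add: \<phi>_def)
  qed simp
  moreover have "(\<phi> has_field_derivative ((y - x) \<bullet> D)) (at 0)"
  proof -
    have "((\<lambda>s. x + s *\<^sub>R (y - x)) has_derivative (\<lambda>s. s *\<^sub>R (y - x))) (at (0::real))"
      by (auto intro!: derivative_eq_intros)
    from diff_chain_at[OF this, of f "\<lambda>h. h \<bullet> D"] deriv show ?thesis
      by (simp add: gderiv_def \<phi>_def[abs_def] o_def has_field_derivative_def mult_commute_abs)
  qed
  ultimately have "(y - x) \<bullet> D * (1 - 0) \<le> \<phi> 1 - \<phi> 0"
    by (intro convex_on_imp_above_tangent) auto
  then show ?thesis by (simp add: \<phi>_def)
qed

lemma strictly_convex_minimizer_unique: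
  assumes strict: "strictly_convex_on UNIV f" and min: "\<And>y. f x \<le> f y" and eq: "f y = f x"
  shows "y = x"
proof (rule ccontr)
  assume "y \<noteq> x"
  then have "f ((1/2) *\<^sub>R y + (1/2) *\<^sub>R x) < 1/2 * f y + 1/2 * f x"
    using strict[unfolded strictly_convex_on_def, THEN conjunct2, rule_format, of y x "1/2" "1/2"]
    by simp
  with min[of "(1/2) *\<^sub>R y + (1/2) *\<^sub>R x"] eq show False by simp
qed

section \<open>Saddle points and the saddle-point field in terms of partial gradients\<close>

locale convex_concave_gradient =
  fixes F :: "'a::euclidean_space \<times> 'b::euclidean_space \<Rightarrow> real"
    and A :: "'a \<times> 'b \<Rightarrow> 'a" and B :: "'a \<times> 'b \<Rightarrow> 'b"
  assumes deriv_fst: "GDERIV (\<lambda>x. F (x, z)) x :> A (x, z)"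
    and deriv_snd: "GDERIV (\<lambda>z. F (x, z)) z :> B (x, z)"
    and cont_F: "continuous_on UNIV F"
    and cont_A: "continuous_on UNIV A" and cont_B: "continuous_on UNIV B"
    and cc: "globally_convex_concave F"
begin

text \<open>Removes the definite description in \<open>gradient\<close>: the field is now expressed
  by \<open>A\<close> and \<open>B\<close>, which the locale assumes jointly continuous.\<close>

lemma X_sp_eq: "X_sp F q = (- A q, B q)"
  by (cases q) (simp add: X_sp_def gradient_eqI[OF deriv_fst] gradient_eqI[OF deriv_snd])

lemma continuous_X_sp: "continuous_on UNIV (X_sp F)"
  unfolding X_sp_eq[abs_def] by (intro continuous_intros cont_A cont_B)

lemma gradient_inequality_fst: "F (x, z) + (y - x) \<bullet> A (x, z) \<le> F (y, z)"
  using convex_gradient_inequality[OF _ deriv_fst] cc by (simp add: globally_convex_concave_def)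

lemma gradient_inequality_snd: "F (x, w) \<le> F (x, z) + (w - z) \<bullet> B (x, z)"
  using convex_gradient_inequality[OF _ GDERIV_minus[OF deriv_snd], of x z w] cc
  by (simp add: globally_convex_concave_def concave_on_def inner_minus_right)

lemma gradient_zero_of_max_snd:
  assumes "open V" "z \<in> V" "\<And>w. w \<in> V \<Longrightarrow> F (x, w) \<le> F (x, z)"
  shows "B (x, z) = 0"
  \<comment> \<open>At an extremum the functional \<open>\<lambda>h. h \<bullet> B (x, z)\<close> is
    zero; it is evaluated at \<open>B (x, z)\<close> itself.\<close>
  using differential_zero_maxmin[OF assms(2,1) deriv_snd[unfolded gderiv_def]] assms(3)
  by (metis inner_eq_zero_iff)

lemma gradient_zero_of_min_fst:
  assumes "open U" "x \<in> U" "\<And>y. y \<in> U \<Longrightarrow> F (x, z) \<le> F (y, z)"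
  shows "A (x, z) = 0"
  using differential_zero_maxmin[OF assms(2,1) deriv_fst[unfolded gderiv_def]] assms(3)
  by (metis inner_eq_zero_iff)

text \<open>Forward, each partial gradient vanishes at a local extremum. Backward, the tangent
  inequalities with zero gradient hold on the whole space, hence the neighborhoods
  \<open>UNIV\<close>. Saddle points are thus exactly the equilibria.\<close>

lemma Saddle_iff: "q \<in> Saddle F \<longleftrightarrow> A q = 0 \<and> B q = 0"
proof (cases q)
  case (Pair x z)
  show ?thesis
  proof
    assume "q \<in> Saddle F"
    then obtain U V where "open U" "x \<in> U" "open V" "z \<in> V"
      and "\<And>y w. y \<in> U \<Longrightarrow> w \<in> V \<Longrightarrow> F (x, w) \<le> F (x, z) \<and> F (x, z) \<le> F (y, z)"
      unfolding Saddle_def Pair by blast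
    then show "A q = 0 \<and> B q = 0"
      using gradient_zero_of_min_fst[of U x z] gradient_zero_of_max_snd[of V z x]
      unfolding Pair by blast
  next
    assume "A q = 0 \<and> B q = 0"
    then show "q \<in> Saddle F"
      using gradient_inequality_fst[of x z] gradient_inequality_snd[of x _ z]
      unfolding Saddle_def Pair by (auto intro!: exI[of _ UNIV])
  qed
qed

lemma Saddle_global:
  assumes "(xs, zs) \<in> Saddle F"
  shows "F (xs, z) \<le> F (xs, zs)" "F (xs, zs) \<le> F (x, zs)"
  using assms gradient_inequality_fst[of xs zs x] gradient_inequality_snd[of xs z zs]
  by (simp_all add: Saddle_iff)

text \<open>The tangent inequality in the first argument is taken from \<open>q\<close> towards
  \<open>xs\<close>, the one in the second towards \<open>zs\<close>; on adding them the value
  \<open>F q\<close> cancels.\<close>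

lemma X_sp_inner_le:
  "X_sp F q \<bullet> (q - (xs, zs)) \<le> F (xs, snd q) - F (fst q, zs)"
  using gradient_inequality_fst[of "fst q" "snd q" xs] gradient_inequality_snd[of "fst q" zs "snd q"]
  by (simp add: X_sp_eq inner_prod_def inner_diff_left inner_diff_right inner_commute)

text \<open>\<open>F (xs, zs)\<close> separates the two values in the bound
  \<open>X_sp_inner_le\<close>. This provides the dissipation hypothesis of the trajectory
  lemmas.\<close>

lemma X_sp_inner_nonpos:
  assumes "p \<in> Saddle F"
  shows "X_sp F q \<bullet> (q - p) \<le> 0"
proof (cases p)
  case (Pair xs zs)
  then show ?thesis
    using X_sp_inner_le[of q xs zs] Saddle_global(1)[of xs zs "snd q"]
      Saddle_global(2)[of xs zs "fst q"] assms by auto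
qed

section \<open>Convergence of trajectories and stability\<close>

lemma trajectory_gap_tendsto_zero:
  assumes traj: "is_trajectory (X_sp F) \<gamma>" and saddle: "(xs, zs) \<in> Saddle F"
  shows "((\<lambda>t. F (fst (\<gamma> t), zs) - F (xs, snd (\<gamma> t))) \<longlongrightarrow> 0) at_top"
\<comment> \<open>The gap lies between 0, by the saddle inequalities, and the dissipation rate,
  which tends to 0.\<close>
proof (rule tendsto_sandwich[where f = "\<lambda>_. 0"])
  have le: "X_sp F q \<bullet> (q - (xs, zs)) \<le> 0" for q using X_sp_inner_nonpos[OF saddle] .
  show "((\<lambda>t. - (X_sp F (\<gamma> t) \<bullet> (\<gamma> t - (xs, zs)))) \<longlongrightarrow> 0) at_top"
    using tendsto_minus[OF trajectory_inner_tendsto_zero[OF traj le continuous_X_sp]] by simp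
  show "\<forall>\<^sub>F t in at_top. F (fst (\<gamma> t), zs) - F (xs, snd (\<gamma> t))
      \<le> - (X_sp F (\<gamma> t) \<bullet> (\<gamma> t - (xs, zs)))"
    using X_sp_inner_le by (intro always_eventually allI) (smt (verit))
  show "\<forall>\<^sub>F t in at_top. 0 \<le> F (fst (\<gamma> t), zs) - F (xs, snd (\<gamma> t))"
    using Saddle_global[OF saddle] by (intro always_eventually allI) (smt (verit))
qed simp

lemma trajectory_tendsto_saddle:
  assumes strict: "globally_strictly_convex_concave F" and saddle: "(xs, zs) \<in> Saddle F"
    and traj: "is_trajectory (X_sp F) \<gamma>"
  shows "\<exists>q\<in>Saddle F. (\<gamma> \<longlongrightarrow> q) at_top"
proof -
  define gap where "gap q = F (fst q, zs) - F (xs, snd q)" for q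
  have bdd: "bounded (\<gamma> ` {0..})"
    using trajectory_bounded[OF traj X_sp_inner_nonpos[OF saddle]] .
  note min = Saddle_global(2)[OF saddle] and max = Saddle_global(1)[OF saddle]
  have gap: "((\<lambda>t. gap (\<gamma> t)) \<longlongrightarrow> 0) at_top"
    unfolding gap_def using trajectory_gap_tendsto_zero[OF traj saddle] .
  have cont_gap: "continuous_on UNIV gap" unfolding gap_def[abs_def]
    by (intro continuous_intros continuous_on_compose2[OF cont_F]) auto
  \<comment> \<open>\<open>gap q\<close> is the sum of the nonnegative terms
    \<open>F (fst q, zs) - F (xs, zs)\<close> and \<open>F (xs, zs) - F (xs, snd q)\<close>.\<close>
  have gap0: "F (fst q, zs) = F (xs, zs) \<and> F (xs, snd q) = F (xs, zs)" if "gap q = 0" for q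
    using that min[of "fst q"] max[of "snd q"] by (simp add: gap_def)
  note uc = trajectory_uniformly_continuous[OF traj bdd continuous_X_sp]
  have deriv: "(\<gamma> has_vector_derivative (- A (\<gamma> t), B (\<gamma> t))) (at t within {0..})" if "t \<ge> 0" for t
    using traj that by (simp add: is_trajectory_def X_sp_eq)
  have AB: "((\<lambda>t. (A (\<gamma> t), B (\<gamma> t))) \<longlongrightarrow> 0) at_top"
  proof -
    \<comment> \<open>The alternative is taken at the saddle point itself, so one case governs the
      whole trajectory.\<close>
    consider "strictly_convex_on UNIV (\<lambda>x. F (x, zs))"
      | "strictly_concave_on UNIV (\<lambda>z. F (xs, z))"
      using strict by (auto simp: globally_strictly_convex_concave_def)
    then show ?thesis
    proof cases
      case 1
      have fst0: "fst q = xs" if "gap q = 0" for q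
        using strictly_convex_minimizer_unique[OF 1, of xs "fst q"] min gap0[OF that] by simp
      have "((\<lambda>t. fst (\<gamma> t) - xs) \<longlongrightarrow> 0) at_top"
        by (rule tendsto_zero_of_zero_set[OF bdd cont_gap _ gap])
          (auto intro!: continuous_intros simp: fst0)
      \<comment> \<open>\<open>gap q = 0\<close> does not determine \<open>snd q\<close> and need
        not force \<open>A q = 0\<close>; instead \<open>barbalat\<close> is applied to the
        convergent first component, whose derivative is \<open>- A\<close>.\<close>
      moreover have "((\<lambda>t. fst (\<gamma> t) - xs) has_vector_derivative - A (\<gamma> t)) (at t within {0..})"
        if "t \<ge> 0" for t
        using bounded_linear.has_vector_derivative[OF bounded_linear_fst deriv[OF that]]
        by (auto simp: has_vector_derivative_diff_const)
      moreover have "uniformly_continuous_on {0..} (\<lambda>t. - A (\<gamma> t))"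
        by (intro uc continuous_intros cont_A)
      ultimately have "((\<lambda>t. - A (\<gamma> t)) \<longlongrightarrow> 0) at_top" by (intro barbalat)
      then have A: "((\<lambda>t. A (\<gamma> t)) \<longlongrightarrow> 0) at_top" using tendsto_minus by fastforce
      \<comment> \<open>Here \<open>fst q = xs\<close>, and \<open>snd q\<close> maximizes
        \<open>\<lambda>z. F (xs, z)\<close>.\<close>
      have "B q = 0" if "gap q = 0" for q
        using gradient_zero_of_max_snd[of UNIV "snd q" "fst q"] fst0[OF that] gap0[OF that] max
        by auto
      then have "((\<lambda>t. B (\<gamma> t)) \<longlongrightarrow> 0) at_top"
        by (intro tendsto_zero_of_zero_set[OF bdd cont_gap cont_B gap])
      from tendsto_Pair[OF A this] show ?thesis by (simp add: zero_prod_def)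
    next
      case 2
      \<comment> \<open>The roles of \<open>A\<close> and \<open>B\<close> are exchanged:
        \<open>zs\<close> is the unique minimizer of the negated function, which is strictly
        convex.\<close>
      have snd0: "snd q = zs" if "gap q = 0" for q
        using strictly_convex_minimizer_unique[OF 2[unfolded strictly_concave_on_def], of zs "snd q"]
          max gap0[OF that] by simp
      have "((\<lambda>t. snd (\<gamma> t) - zs) \<longlongrightarrow> 0) at_top"
        by (rule tendsto_zero_of_zero_set[OF bdd cont_gap _ gap])
          (auto intro!: continuous_intros simp: snd0)
      moreover have "((\<lambda>t. snd (\<gamma> t) - zs) has_vector_derivative B (\<gamma> t)) (at t within {0..})"
        if "t \<ge> 0" for t
        using bounded_linear.has_vector_derivative[OF bounded_linear_snd deriv[OF that]]
        by (auto simp: has_vector_derivative_diff_const)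
      moreover have "uniformly_continuous_on {0..} (\<lambda>t. B (\<gamma> t))"
        by (intro uc cont_B)
      ultimately have B: "((\<lambda>t. B (\<gamma> t)) \<longlongrightarrow> 0) at_top" by (intro barbalat)
      have "A q = 0" if "gap q = 0" for q
        using gradient_zero_of_min_fst[of UNIV "fst q" "snd q"] snd0[OF that] gap0[OF that] min
        by auto
      then have "((\<lambda>t. A (\<gamma> t)) \<longlongrightarrow> 0) at_top"
        by (intro tendsto_zero_of_zero_set[OF bdd cont_gap cont_A gap])
      from tendsto_Pair[OF this B] show ?thesis by (simp add: zero_prod_def)
    qed
  qed
  \<comment> \<open>The zeros of \<open>(A, B)\<close> are the saddle points, and distances to them
    never increase. The limit \<open>q\<close> need not be \<open>(xs, zs)\<close>.\<close>
  have "\<exists>q. (A q, B q) = 0 \<and> (\<gamma> \<longlongrightarrow> q) at_top"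
    by (rule trajectory_tendsto_zero_of_attracting[OF traj bdd _ _ AB])
      (auto intro!: continuous_intros cont_A cont_B X_sp_inner_nonpos simp: Saddle_iff zero_prod_def)
  then show ?thesis by (auto simp: Saddle_iff zero_prod_def)
qed

theorem saddle_dynamics_stable:
  assumes strict: "globally_strictly_convex_concave F" and ne: "Saddle F \<noteq> {}"
  shows "globally_asymptotically_stable (X_sp F) (Saddle F)"
    and "convergence_to_a_point (X_sp F) (Saddle F)"
proof -
  have conv: "\<exists>q\<in>Saddle F. (\<gamma> \<longlongrightarrow> q) at_top" if "is_trajectory (X_sp F) \<gamma>" for \<gamma>
    using trajectory_tendsto_saddle[OF strict _ that] ne by fastforce
  then show "convergence_to_a_point (X_sp F) (Saddle F)"
    by (simp add: convergence_to_a_point_def)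
  show "globally_asymptotically_stable (X_sp F) (Saddle F)"
    unfolding globally_asymptotically_stable_def
  proof (intro conjI allI impI ballI)
    show "X_sp F p = 0" if "p \<in> Saddle F" for p
      using that by (simp add: X_sp_eq Saddle_iff zero_prod_def)
  next
    fix e :: real assume "e > 0"
    show "\<exists>W. open W \<and> Saddle F \<subseteq> W \<and> (\<forall>\<gamma>. is_trajectory (X_sp F) \<gamma> \<longrightarrow> \<gamma> 0 \<in> W \<longrightarrow>
        (\<forall>t\<ge>0. infdist (\<gamma> t) (Saddle F) < e))"
    \<comment> \<open>Balls of the same radius \<open>e\<close> suffice, as the distance to each
      saddle point never increases.\<close>
    proof (intro exI[of _ "\<Union>p\<in>Saddle F. ball p e"] conjI allI impI)
      fix \<gamma> t assume traj: "is_trajectory (X_sp F) \<gamma>" and "\<gamma> 0 \<in> (\<Union>p\<in>Saddle F. ball p e)"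
        and t: "(t::real) \<ge> 0"
      then obtain p where p: "p \<in> Saddle F" "dist (\<gamma> 0) p < e" by (auto simp: dist_commute)
      have "infdist (\<gamma> t) (Saddle F) \<le> dist (\<gamma> t) p" by (rule infdist_le[OF p(1)])
      also have "\<dots> \<le> dist (\<gamma> 0) p"
        using trajectory_dist_antimono[OF traj X_sp_inner_nonpos[OF p(1)] _ t] by simp
      finally show "infdist (\<gamma> t) (Saddle F) < e" using p(2) by simp
    qed (use \<open>e > 0\<close> in auto)
  next
    fix \<gamma> assume "is_trajectory (X_sp F) \<gamma>"
    then obtain q where q: "q \<in> Saddle F" "(\<gamma> \<longlongrightarrow> q) at_top" using conv by blast
    \<comment> \<open>Attraction follows from convergence to a point: \<open>infdist\<close> is
      continuous and vanishes at \<open>q\<close>.\<close>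
    show "((\<lambda>t. infdist (\<gamma> t) (Saddle F)) \<longlongrightarrow> 0) at_top"
      using tendsto_infdist[OF q(2), of "Saddle F"] q(1) by simp
  qed
qed

end

section \<open>Partial gradients of a jointly differentiable function\<close>

lemma convex_concave_gradientI:
  fixes F :: "'a::euclidean_space \<times> 'b::euclidean_space \<Rightarrow> real"
  assumes G: "\<And>q. GDERIV F q :> G q" and cont: "continuous_on UNIV G"
    and cc: "globally_convex_concave F"
  shows "convex_concave_gradient F (\<lambda>q. fst (G q)) (\<lambda>q. snd (G q))"
proof
  have F: "(F has_derivative (\<lambda>h. h \<bullet> G q)) (at q)" for q
    using G by (simp add: gderiv_def)
  show "GDERIV (\<lambda>x. F (x, z)) x :> fst (G (x, z))" for x z
  proof -
    \<comment> \<open>Chain rule along an affine slice: pairing \<open>(h, 0)\<close> with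
      \<open>G (x, z)\<close> leaves \<open>h \<bullet> fst (G (x, z))\<close>.\<close>
    have "((\<lambda>x. (x, z)) has_derivative (\<lambda>h. (h, 0))) (at x)"
      by (auto intro!: derivative_eq_intros)
    from diff_chain_at[OF this F] show ?thesis
      by (simp add: gderiv_def o_def inner_prod_def)
  qed
  show "GDERIV (\<lambda>z. F (x, z)) z :> snd (G (x, z))" for x z
  proof -
    have "((\<lambda>z. (x, z)) has_derivative (\<lambda>h. (0, h))) (at z)"
      by (auto intro!: derivative_eq_intros)
    from diff_chain_at[OF this F] show ?thesis
      by (simp add: gderiv_def o_def inner_prod_def)
  qed
  show "continuous_on UNIV F"
    using has_derivative_continuous[OF F] by (simp add: continuous_on_eq_continuous_within)
qed (intro cc continuous_intros cont)+

theorem corollary4p2: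
  fixes F :: "(real ^ 'n) \<times> (real ^ 'm) \<Rightarrow> real"
  assumes "continuously_differentiable F"
    and "globally_strictly_convex_concave F"
    and "Saddle F \<noteq> {}"
  shows "globally_asymptotically_stable (X_sp F) (Saddle F) \<and>
         convergence_to_a_point (X_sp F) (Saddle F)"
proof -
  obtain G where "\<And>q. GDERIV F q :> G q" "continuous_on UNIV G"
    using assms(1) by (auto simp: continuously_differentiable_def)
  moreover have "globally_convex_concave F"
    using assms(2) by (simp add: globally_strictly_convex_concave_def)
  ultimately interpret convex_concave_gradient F "\<lambda>q. fst (G q)" "\<lambda>q. snd (G q)"
    by (rule convex_concave_gradientI)
  show ?thesis using saddle_dynamics_stable[OF assms(2,3)] by blast
qed

end
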